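(* Let $\{T_\theta\}_{\theta\in U}$ satisfy the standing assumptions (i)–(iv) of the context. Let $\{\theta_\varepsilon^{c}\}_{\varepsilon\downarrow0}$ be a center family, take the petal family $\theta_\varepsilon^{p}\equiv\bar\theta$, and suppose $D_\varepsilon:=\inf_{z\in V_\varepsilon^{c}}\|z\|_{\mathcal H}\to\infty$ as $\varepsilon\downarrow0$. Fix $\gamma\in(0,1)$ and nonnegative reals $\{\nu_\varepsilon\}_{\varepsilon\downarrow0}$ with $\nu_\varepsilon\to0$. With $g_{\bar\theta}(D):=\min_{\|z\|_{\mathcal H}\le D}\|\delta_{\bar\theta}(z)-v_{\bar\theta}\|_{\mathcal H}$, let $$\mathcal S_\varepsilon:=\{z\in\mathcal H:\ \|z\|_{\mathcal H}\le D_\varepsilon^{\gamma},\ \|\delta_{\bar\theta}(z)-v_{\bar\theta}\|_{\mathcal H}\le g_{\bar\theta}(D_\varepsilon^{\gamma})+\nu_\varepsilon\}.$$ Then $\{\mathcal S_\varepsilon\}_{\varepsilon\downarrow0}$ is an afterimage slow region family for $\{\theta_\varepsilon^{c}\}$ with respect to $\{\theta_\varepsilon^{p}\}$, with vanishing modulus $\rho_\varepsilon=O\big(D_\varepsilon^{-1}+D_\varepsilon^{\gamma-1}\cdot\|\theta_\varepsilon^{c}-\bar\theta\|_{\mathcal D}\big)$.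
   Context: **Setting.** $\mathcal X,\mathcal Y,\mathcal H$ are finite-dimensional real Hilbert spaces, $\mathcal K\subseteq\mathcal X$ is a closed convex cone with dual cone $\mathcal K^*$. A parameter is $\theta=(\mathcal A,b,c)\in\mathcal D:=\mathcal L(\mathcal X,\mathcal Y)\times\mathcal Y\times\mathcal X$ (with $\mathcal L(\mathcal X,\mathcal Y)$ the linear maps), normed by $\|\theta\|_{\mathcal D}^2:=\|\mathcal A\|_{\mathrm{HS}}^2+\|b\|_{\mathcal Y}^2+\|c\|_{\mathcal X}^2$. Put $\mathrm{KKT}(\theta):=\{(x,y,s):\mathcal Ax=b,\ \mathcal A^*y+s=c,\ \langle x,s\rangle_{\mathcal X}=0,\ x\in\mathcal K,\ s\in\mathcal K^*\}$ and $\mathcal D_{\mathrm{KKT}}:=\{\theta\in\mathcal D:\mathrm{KKT}(\theta)\ne\emptyset\}$. Let $\bar\theta\in\mathrm{cl}(\mathcal D_{\mathrm{KKT}})$ and let $U\subset\mathcal D$ be compact with $\bar\theta\in U$ ($\bar\theta$ itself need not lie in $\mathcal D_{\mathrm{KKT}}$). To each $\theta\in U$ is associated a map $T_\theta:\mathcal H\to\mathcal H$, with residual map $\delta_\theta:=T_\theta-\mathrm{Id}$ and fixed point set $\mathrm{Fix}(T_\theta)$. **Standing assumptions.** (i) For every $\theta\in U$: $\mathrm{Fix}(T_\theta)\ne\emptyset$ iff $\theta\in\mathcal D_{\mathrm{KKT}}$. (ii) For every $\theta\in U$, $T_\theta$ is $\alpha_\theta$-averaged for some $\alpha_\theta\in(0,1)$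 (i.e. $T_\theta=(1-\alpha_\theta)\mathrm{Id}+\alpha_\theta N_\theta$ with $N_\theta$ nonexpansive) with respect to the inner product $\langle z,w\rangle_\theta:=\langle z,G_\theta w\rangle_{\mathcal H}$, $G_\theta$ self-adjoint positive definite on $\mathcal H$. (iii) There are $0<m_U\le M_U<\infty$ with $m_U\mathrm{Id}\preceq G_\theta\preceq M_U\mathrm{Id}$ for all $\theta\in U$. (iv) There is $L_U(r)=a+a'r$ with $a,a'\ge0$ such that $\|T_\theta z-T_{\theta'}z\|_{\mathcal H}\le L_U(\|z\|_{\mathcal H})\,\|\theta-\theta'\|_{\mathcal D}$ for all $\theta,\theta'\in U$, $z\in\mathcal H$. **Drift.** For $\theta\in U$, the forward drift $v_\theta$ is the projection of $0$ onto the closed convex set $\mathrm{cl}(\mathrm{ran}(\delta_\theta))$ in the norm $\|\cdot\|_\theta$ induced by $\langle\cdot,\cdot\rangle_\theta$. **Families.** All conditions on families indexed by $\varepsilon\downarrow0$ are required only for all sufficiently small $\varepsilon>0$. A center family is $\{\theta_\varepsilon^{c}\}_{\varepsilon\downarrow0}\subset U\cap\mathcal D_{\mathrm{KKT}}$ with $\theta_\varepsilon^{c}\to\bar\theta$; a petal family is $\{\theta_\varepsilon^{p}\}_{\varepsilon\downarrow0}\subset U$ with $\theta_\varepsilon^{p}\to\bar\theta$. Write $\delta_\varepsilon^{c}:=\delta_{\theta_\varepsilon^{c}}$, $\delta_\varepsilon^{p}:=\delta_{\theta_\varepsilon^{p}}$, $v_\varepsilon^{p}:=v_{\theta_\varepsilon^{p}}$,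 $V_\varepsilon^{c}:=\mathrm{Fix}(T_{\theta_\varepsilon^{c}})$. $\mathrm{dist}_{\mathcal H}$ is the distance in $\|\cdot\|_{\mathcal H}$. **Slow region (SR) family.** $\{\mathcal S_\varepsilon\}_{\varepsilon\downarrow0}$, $\mathcal S_\varepsilon\subset\mathcal H$, is an SR family of $\{\theta_\varepsilon^{c}\}$ iff (1) $\mathcal S_\varepsilon\ne\emptyset$ and $\mathcal S_\varepsilon\cap V_\varepsilon^{c}=\emptyset$; (2) its vanishing modulus $\rho_\varepsilon:=\sup_{z\in\mathcal S_\varepsilon}\|\delta_\varepsilon^{c}(z)\|_{\mathcal H}/\mathrm{dist}_{\mathcal H}(z,V_\varepsilon^{c})$ is finite and $\rho_\varepsilon\to0$. **Afterimage slow region (ASR) family.** An SR family $\{\mathcal S_\varepsilon\}$ of $\{\theta_\varepsilon^{c}\}$ is an ASR family with respect to a petal family $\{\theta_\varepsilon^{p}\}$ iff there are $\mu_\varepsilon\ge0$ with $\mu_\varepsilon\to0$ and $\|\delta_\varepsilon^{p}(z)-v_\varepsilon^{p}\|_{\mathcal H}\le\mu_\varepsilon$ for all $z\in\mathcal S_\varepsilon$. *)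

theory Defs
  imports "HOL-Analysis.Analysis" "HOL-Library.Landau_Symbols"
begin

section \<open>Linear maps with the Hilbert--Schmidt inner product\<close>

text \<open>
  The library type of bounded linear maps carries the operator norm, so the space of linear maps
  is introduced here as a type whose norm is the Hilbert--Schmidt norm.
\<close>

typedef (overloaded) ('a::euclidean_space, 'b::euclidean_space) hs_map =
    "{f :: 'a \<Rightarrow> 'b. linear f}"
  morphisms hs_apply Hs_map
  using linear_zero by blast

setup_lifting type_definition_hs_map

instantiation hs_map :: (euclidean_space, euclidean_space) real_inner
begin

lift_definition zero_hs_map :: "('a, 'b) hs_map" is "\<lambda>x. 0"
  by (rule linear_zero)

lift_definition plus_hs_map :: "('a, 'b) hs_map \<Rightarrow> ('a, 'b) hs_map \<Rightarrow> ('a, 'b) hs_map"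
  is "\<lambda>f g x. f x + g x"
  by (rule linear_compose_add)

lift_definition uminus_hs_map :: "('a, 'b) hs_map \<Rightarrow> ('a, 'b) hs_map"
  is "\<lambda>f x. - f x"
  by (rule linear_compose_neg)

lift_definition minus_hs_map :: "('a, 'b) hs_map \<Rightarrow> ('a, 'b) hs_map \<Rightarrow> ('a, 'b) hs_map"
  is "\<lambda>f g x. f x - g x"
  by (rule linear_compose_sub)

lift_definition scaleR_hs_map :: "real \<Rightarrow> ('a, 'b) hs_map \<Rightarrow> ('a, 'b) hs_map"
  is "\<lambda>r f x. r *\<^sub>R f x"
  by (rule linear_compose_scale_right)

definition inner_hs_map :: "('a, 'b) hs_map \<Rightarrow> ('a, 'b) hs_map \<Rightarrow> real"
  where "inner_hs_map A B = (\<Sum>e\<in>Basis. hs_apply A e \<bullet> hs_apply B e)"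

definition norm_hs_map :: "('a, 'b) hs_map \<Rightarrow> real"
  where "norm_hs_map A = sqrt (A \<bullet> A)"

definition dist_hs_map :: "('a, 'b) hs_map \<Rightarrow> ('a, 'b) hs_map \<Rightarrow> real"
  where "dist_hs_map A B = norm (A - B)"

definition sgn_hs_map :: "('a, 'b) hs_map \<Rightarrow> ('a, 'b) hs_map"
  where "sgn_hs_map A = inverse (norm A) *\<^sub>R A"

definition uniformity_hs_map :: "(('a, 'b) hs_map \<times> ('a, 'b) hs_map) filter"
  where "uniformity_hs_map = (INF e\<in>{0<..}. principal {(A, B). dist A B < e})"

definition open_hs_map :: "('a, 'b) hs_map set \<Rightarrow> bool"
  where "open_hs_map S = (\<forall>A\<in>S. \<forall>\<^sub>F (A', B) in uniformity. A' = A \<longrightarrow> B \<in> S)"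

instance
proof
  fix A B C :: "('a, 'b) hs_map" and r s :: real
  show "A + B + C = A + (B + C)" "A + B = B + A" "0 + A = A" "- A + A = 0" "A - B = A + - B"
    by (transfer; simp add: algebra_simps)+
  show "r *\<^sub>R (A + B) = r *\<^sub>R A + r *\<^sub>R B" "(r + s) *\<^sub>R A = r *\<^sub>R A + s *\<^sub>R A"
    "r *\<^sub>R s *\<^sub>R A = (r * s) *\<^sub>R A" "1 *\<^sub>R A = A"
    by (transfer; simp add: algebra_simps)+
  show "dist A B = norm (A - B)" by (rule dist_hs_map_def)
  show "sgn A = inverse (norm A) *\<^sub>R A" by (rule sgn_hs_map_def)
  show "uniformity = (INF e\<in>{0<..}. principal {(A, B :: ('a, 'b) hs_map). dist A B < e})"
    by (rule uniformity_hs_map_def)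
  show "open S = (\<forall>A\<in>S. \<forall>\<^sub>F (A', B) in uniformity. A' = A \<longrightarrow> B \<in> S)"
    for S :: "('a, 'b) hs_map set"
    by (rule open_hs_map_def)
  show "A \<bullet> B = B \<bullet> A"
    by (simp add: inner_hs_map_def inner_commute)
  show "(A + B) \<bullet> C = A \<bullet> C + B \<bullet> C"
    by (simp add: inner_hs_map_def plus_hs_map.rep_eq inner_add_left sum.distrib)
  show "r *\<^sub>R A \<bullet> B = r * (A \<bullet> B)"
    by (simp add: inner_hs_map_def scaleR_hs_map.rep_eq sum_distrib_left)
  show "0 \<le> A \<bullet> A"
    by (simp add: inner_hs_map_def sum_nonneg)
  show "(A \<bullet> A = 0) = (A = 0)"
  proof
    assume "A \<bullet> A = 0"
    then have "\<forall>e\<in>Basis. hs_apply A e = 0"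
      by (simp add: inner_hs_map_def sum_nonneg_eq_0_iff)
    moreover have "linear (hs_apply A)"
      using hs_apply by blast
    ultimately have "hs_apply A = (\<lambda>x. 0)"
      using linear_eq_stdbasis linear_zero by metis
    then show "A = 0"
      by transfer simp
  qed (simp add: inner_hs_map_def zero_hs_map.rep_eq)
  show "norm A = sqrt (A \<bullet> A)" by (rule norm_hs_map_def)
qed

end

type_synonym ('x, 'y) param = "('x, 'y) hs_map \<times> 'y \<times> 'x"

lemma norm_param_squared:
  fixes A :: "('x::euclidean_space, 'y::euclidean_space) hs_map"
  shows "(norm (A, b, c))\<^sup>2 = (\<Sum>e\<in>Basis. (norm (hs_apply A e))\<^sup>2) + (norm b)\<^sup>2 + (norm c)\<^sup>2"
  by (simp add: norm_Pair power2_norm_eq_inner inner_hs_map_def sum_nonneg flip: add.assoc)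


section \<open>The KKT system\<close>

definition dual_cone :: "'x::real_inner set \<Rightarrow> 'x set"
  where "dual_cone K = {s. \<forall>x\<in>K. 0 \<le> x \<bullet> s}"

definition KKT ::
  "'x set \<Rightarrow> ('x::euclidean_space, 'y::euclidean_space) param \<Rightarrow> ('x \<times> 'y \<times> 'x) set"
  where "KKT K \<theta> = (case \<theta> of (A, b, c) \<Rightarrow>
    {(x, y, s). hs_apply A x = b \<and> adjoint (hs_apply A) y + s = c \<and> x \<bullet> s = 0 \<and>
       x \<in> K \<and> s \<in> dual_cone K})"

definition D_KKT :: "'x set \<Rightarrow> ('x::euclidean_space, 'y::euclidean_space) param set"
  where "D_KKT K = {\<theta>. KKT K \<theta> \<noteq> {}}"


section \<open>Averaged operators in a variable metric\<close>

definition fixed_points :: "('h \<Rightarrow> 'h) \<Rightarrow> 'h set"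
  where "fixed_points T = {z. T z = z}"

definition residual :: "('h \<Rightarrow> 'h) \<Rightarrow> 'h \<Rightarrow> 'h::real_vector"
  where "residual T z = T z - z"

definition selfadjoint_posdef :: "('h \<Rightarrow> 'h::real_inner) \<Rightarrow> bool"
  where "selfadjoint_posdef G \<longleftrightarrow>
    linear G \<and> (\<forall>z w. G z \<bullet> w = z \<bullet> G w) \<and> (\<forall>z. z \<noteq> 0 \<longrightarrow> 0 < z \<bullet> G z)"

definition norm_wrt :: "('h \<Rightarrow> 'h) \<Rightarrow> 'h::real_inner \<Rightarrow> real"
  where "norm_wrt G z = sqrt (z \<bullet> G z)"

definition nonexpansive_wrt :: "('h \<Rightarrow> 'h) \<Rightarrow> ('h \<Rightarrow> 'h::real_inner) \<Rightarrow> bool"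
  where "nonexpansive_wrt G N \<longleftrightarrow> (\<forall>z w. norm_wrt G (N z - N w) \<le> norm_wrt G (z - w))"

definition averaged_wrt :: "('h \<Rightarrow> 'h) \<Rightarrow> real \<Rightarrow> ('h \<Rightarrow> 'h::real_inner) \<Rightarrow> bool"
  where "averaged_wrt G \<alpha> T \<longleftrightarrow>
    (\<exists>N. nonexpansive_wrt G N \<and> (\<forall>z. T z = (1 - \<alpha>) *\<^sub>R z + \<alpha> *\<^sub>R N z))"

text \<open>As the library's \<open>closest_point\<close>, with the norm induced by \<open>G\<close> in place of the ambient one.\<close>

definition closest_point_wrt :: "('h \<Rightarrow> 'h) \<Rightarrow> 'h set \<Rightarrow> 'h \<Rightarrow> 'h::real_inner"
  where "closest_point_wrt G S a =
    (SOME v. v \<in> S \<and> (\<forall>w\<in>S. norm_wrt G (a - v) \<le> norm_wrt G (a - w)))"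

definition drift :: "('h \<Rightarrow> 'h) \<Rightarrow> ('h \<Rightarrow> 'h) \<Rightarrow> 'h::real_inner"
  where "drift G T = closest_point_wrt G (closure (range (residual T))) 0"


section \<open>Families\<close>

text \<open>
  A family indexed by \<open>\<epsilon> \<down> 0\<close> is a total function on the reals of which only the germ along
  \<open>at_right 0\<close> matters. The parameter \<open>T\<close> below is the whole operator family \<open>\<theta> \<mapsto> T\<^sub>\<theta>\<close>,
  and \<open>G\<close> the family of metrics \<open>\<theta> \<mapsto> G\<^sub>\<theta>\<close>.
\<close>

definition center_family ::
  "'x set \<Rightarrow> ('x::euclidean_space, 'y::euclidean_space) param set \<Rightarrow> ('x, 'y) param \<Rightarrow>
   (real \<Rightarrow> ('x, 'y) param) \<Rightarrow> bool"
  where "center_family K U \<theta>bar \<theta>c \<longleftrightarrow>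
    (\<forall>\<^sub>F \<epsilon> in at_right 0. \<theta>c \<epsilon> \<in> U \<inter> D_KKT K) \<and> (\<theta>c \<longlongrightarrow> \<theta>bar) (at_right 0)"

definition petal_family ::
  "('x::euclidean_space, 'y::euclidean_space) param set \<Rightarrow> ('x, 'y) param \<Rightarrow>
   (real \<Rightarrow> ('x, 'y) param) \<Rightarrow> bool"
  where "petal_family U \<theta>bar \<theta>p \<longleftrightarrow>
    (\<forall>\<^sub>F \<epsilon> in at_right 0. \<theta>p \<epsilon> \<in> U) \<and> (\<theta>p \<longlongrightarrow> \<theta>bar) (at_right 0)"

text \<open>
  The supremum is that of the reals, hence meaningful only for a nonempty \<open>S \<epsilon>\<close> on which the
  quotient is bounded above; \<open>SR_family\<close> demands both.
\<close>

definition vanishing_modulus ::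
  "('p \<Rightarrow> 'h \<Rightarrow> 'h::real_normed_vector) \<Rightarrow> (real \<Rightarrow> 'p) \<Rightarrow> (real \<Rightarrow> 'h set) \<Rightarrow> real \<Rightarrow> real"
  where "vanishing_modulus T \<theta>c S \<epsilon> =
    (SUP z\<in>S \<epsilon>. norm (residual (T (\<theta>c \<epsilon>)) z) / infdist z (fixed_points (T (\<theta>c \<epsilon>))))"

definition SR_family ::
  "('p \<Rightarrow> 'h \<Rightarrow> 'h::real_normed_vector) \<Rightarrow> (real \<Rightarrow> 'p) \<Rightarrow> (real \<Rightarrow> 'h set) \<Rightarrow> bool"
  where "SR_family T \<theta>c S \<longleftrightarrow>
    (\<forall>\<^sub>F \<epsilon> in at_right 0. S \<epsilon> \<noteq> {} \<and> S \<epsilon> \<inter> fixed_points (T (\<theta>c \<epsilon>)) = {}) \<and>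
    (\<forall>\<^sub>F \<epsilon> in at_right 0. bdd_above
       ((\<lambda>z. norm (residual (T (\<theta>c \<epsilon>)) z) / infdist z (fixed_points (T (\<theta>c \<epsilon>)))) ` S \<epsilon>)) \<and>
    (vanishing_modulus T \<theta>c S \<longlongrightarrow> 0) (at_right 0)"

definition ASR_family ::
  "('p \<Rightarrow> 'h \<Rightarrow> 'h) \<Rightarrow> ('p \<Rightarrow> 'h \<Rightarrow> 'h::real_inner) \<Rightarrow> (real \<Rightarrow> 'p) \<Rightarrow> (real \<Rightarrow> 'p) \<Rightarrow>
   (real \<Rightarrow> 'h set) \<Rightarrow> bool"
  where "ASR_family G T \<theta>c \<theta>p S \<longleftrightarrow> SR_family T \<theta>c S \<and>
    (\<exists>\<mu> :: real \<Rightarrow> real. (\<forall>\<^sub>F \<epsilon> in at_right 0. 0 \<le> \<mu> \<epsilon>) \<and> (\<mu> \<longlongrightarrow> 0) (at_right 0) \<and>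
      (\<forall>\<^sub>F \<epsilon> in at_right 0. \<forall>z\<in>S \<epsilon>.
         norm (residual (T (\<theta>p \<epsilon>)) z - drift (G (\<theta>p \<epsilon>)) (T (\<theta>p \<epsilon>))) \<le> \<mu> \<epsilon>))"


section \<open>The slow region cut out by the drift gap\<close>

definition fix_radius :: "('h \<Rightarrow> 'h::real_normed_vector) \<Rightarrow> real"
  where "fix_radius T = (INF z\<in>fixed_points T. norm z)"

text \<open>
  For a continuous \<open>T\<close> and \<open>0 \<le> D\<close> the infimum below is a minimum, by compactness of the ball
  (lemma \<open>drift_gap_attained\<close>).
\<close>

definition drift_gap :: "('h \<Rightarrow> 'h) \<Rightarrow> ('h \<Rightarrow> 'h::real_inner) \<Rightarrow> real \<Rightarrow> real"
  where "drift_gap G T D = (INF z\<in>{z. norm z \<le> D}. norm (residual T z - drift G T))"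

lemma drift_gap_attained:
  fixes T :: "'h::euclidean_space \<Rightarrow> 'h"
  assumes "continuous_on UNIV T" and "0 \<le> D"
  obtains z where "norm z \<le> D" "drift_gap G T D = norm (residual T z - drift G T)"
    "\<And>w. norm w \<le> D \<Longrightarrow> drift_gap G T D \<le> norm (residual T w - drift G T)"
proof -
  let ?f = "\<lambda>z. norm (residual T z - drift G T)"
  have "continuous_on (cball 0 D) ?f"
    unfolding residual_def
    by (intro continuous_intros continuous_on_subset[OF assms(1)]) auto
  then obtain z where z: "z \<in> cball 0 D" "\<And>w. w \<in> cball 0 D \<Longrightarrow> ?f z \<le> ?f w"
    using continuous_attains_inf[of "cball 0 D" ?f] assms(2) by auto
  moreover have "drift_gap G T D = ?f z"
    unfolding drift_gap_def using z by (intro cInf_eq_minimum) auto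
  ultimately show thesis
    using that by auto
qed

definition gap_region ::
  "('h \<Rightarrow> 'h) \<Rightarrow> ('h \<Rightarrow> 'h::real_inner) \<Rightarrow> real \<Rightarrow> real \<Rightarrow> 'h set"
  where "gap_region G T R \<nu> =
    {z. norm z \<le> R \<and> norm (residual T z - drift G T) \<le> drift_gap G T R + \<nu>}"

end

theory Submission
  imports Defs "HOL-Real_Asymp.Real_Asymp"
begin

text \<open>
  The residual of the center operator \<open>T (\<theta>c \<epsilon>)\<close> is controlled through the limit operator
  \<open>T \<theta>bar\<close>. On \<open>S \<epsilon>\<close> the residual of \<open>T \<theta>bar\<close> is within the gap plus \<open>\<nu> \<epsilon>\<close> of the drift
  \<open>v\<close>, hence bounded, and the residual of the center differs from it by at most
  \<open>(a + a' * norm z) * norm (\<theta>c \<epsilon> - \<theta>bar)\<close>, where \<open>norm z \<le> D \<epsilon> powr \<gamma>\<close>. So the residual of the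
  center is \<open>O(1 + D \<epsilon> powr \<gamma> * norm (\<theta>c \<epsilon> - \<theta>bar))\<close> on \<open>S \<epsilon>\<close>. The fixed points of the center have
  norm at least \<open>D \<epsilon>\<close>, whereas \<open>S \<epsilon>\<close> lies in the ball of radius \<open>D \<epsilon> powr \<gamma>\<close>, which is at most
  \<open>D \<epsilon> / 2\<close> once \<open>D \<epsilon>\<close> is large because \<open>\<gamma> < 1\<close>. Distances to the fixed point set are
  therefore at least \<open>D \<epsilon> / 2\<close> (\<open>quotient_le_far_from_fixed_points\<close>), and dividing gives the rate of
  the vanishing modulus.

  That the residual of \<open>T \<theta>bar\<close> itself converges to the drift uniformly on \<open>S \<epsilon>\<close> means that the gap
  vanishes as the radius grows. This holds because the drift is a limit of residuals:
  projecting onto the closed set \<open>closure (range (residual T))\<close> attains the distance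
  (\<open>drift_in_closure_range\<close>, \<open>drift_gap_tendsto_0\<close>). Averagedness
  makes \<open>T \<theta>bar\<close> continuous (\<open>continuous_on_averaged\<close>), so the gap is a minimum and \<open>S \<epsilon>\<close> is nonempty.
\<close>

lemma norm_wrt_ge:
  assumes "0 \<le> m" "m * (z \<bullet> z) \<le> z \<bullet> G z"
  shows "sqrt m * norm z \<le> norm_wrt G z"
  using assms by (simp add: norm_wrt_def norm_eq_sqrt_inner flip: real_sqrt_mult)

lemma norm_wrt_le:
  assumes "0 \<le> M" "z \<bullet> G z \<le> M * (z \<bullet> z)"
  shows "norm_wrt G z \<le> sqrt M * norm z"
  using assms by (simp add: norm_wrt_def norm_eq_sqrt_inner flip: real_sqrt_mult)

text \<open>
  The metric is equivalent to the ambient norm, so nonexpansiveness in the metric is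
  Lipschitz continuity with constant \<open>sqrt (M / m)\<close> in the ambient norm.
\<close>

lemma continuous_on_averaged:
  fixes T :: "'h::euclidean_space \<Rightarrow> 'h"
  assumes "averaged_wrt G \<alpha> T" and m: "0 < m" and "0 \<le> M"
    and bounds: "\<And>z. m * (z \<bullet> z) \<le> z \<bullet> G z" "\<And>z. z \<bullet> G z \<le> M * (z \<bullet> z)"
  shows "continuous_on A T"
proof -
  obtain N where N: "nonexpansive_wrt G N" and T: "\<And>z. T z = (1 - \<alpha>) *\<^sub>R z + \<alpha> *\<^sub>R N z"
    using assms(1) by (auto simp: averaged_wrt_def)
  have "(sqrt M / sqrt m)-lipschitz_on A N"
  proof (rule lipschitz_onI)
    fix z w
    have "sqrt m * norm (N z - N w) \<le> norm_wrt G (N z - N w)"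
      using m bounds by (intro norm_wrt_ge) auto
    also have "\<dots> \<le> norm_wrt G (z - w)"
      using N by (simp add: nonexpansive_wrt_def)
    also have "\<dots> \<le> sqrt M * norm (z - w)"
      using \<open>0 \<le> M\<close> bounds by (intro norm_wrt_le) auto
    finally show "dist (N z) (N w) \<le> sqrt M / sqrt m * dist z w"
      using m by (simp add: dist_norm field_simps)
  qed (use m \<open>0 \<le> M\<close> in simp)
  then have "continuous_on A N"
    by (rule lipschitz_on_continuous_on)
  then show ?thesis
    by (subst continuous_on_cong[OF refl T]) (intro continuous_intros)
qed

text \<open>
  \<open>closest_point_wrt\<close> is an arbitrary choice unless a minimizer exists. Coercivity of the metric confines
  the search to a compact piece of the closed set, where continuity provides one.
\<close>

lemma closest_point_wrt_in:
  fixes S :: "'h::euclidean_space set"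
  assumes "closed S" "S \<noteq> {}" "linear G" and m: "0 < m"
    and coercive: "\<And>z. m * (z \<bullet> z) \<le> z \<bullet> G z"
  shows "closest_point_wrt G S a \<in> S"
proof -
  let ?f = "\<lambda>v. norm_wrt G (a - v)"
  obtain s where s: "s \<in> S"
    using assms(2) by blast
  \<comment> \<open>By coercivity, every point at least as good as \<open>s\<close> lies within ambient distance \<open>r\<close> of \<open>a\<close>.\<close>
  define r where "r = ?f s / sqrt m"
  have lower: "sqrt m * norm (a - v) \<le> ?f v" for v
    using m coercive by (intro norm_wrt_ge) auto
  have "bounded_linear G"
    using assms(3) by (simp add: linear_conv_bounded_linear)
  then have "continuous_on (S \<inter> cball a r) (\<lambda>v. G (a - v))"
    by (rule bounded_linear.continuous_on) (intro continuous_intros)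
  then have cont: "continuous_on (S \<inter> cball a r) ?f"
    unfolding norm_wrt_def by (intro continuous_on_real_sqrt continuous_on_inner continuous_on_diff
      continuous_on_const continuous_on_id)
  have near: "v \<in> cball a r" if "?f v \<le> ?f s" for v
    using lower[of v] that m by (simp add: r_def dist_norm field_simps)
  have "compact (S \<inter> cball a r)"
    using assms(1) by (simp add: closed_Int_compact)
  moreover have "S \<inter> cball a r \<noteq> {}"
    using s near by auto
  ultimately obtain v where v: "v \<in> S" "\<And>w. w \<in> S \<inter> cball a r \<Longrightarrow> ?f v \<le> ?f w"
    using continuous_attains_inf[OF _ _ cont] by blast
  have "?f v \<le> ?f w" if "w \<in> S" for w
    using that near[of w] v(2)[of w] v(2)[of s] s near[of s] by (cases "?f w \<le> ?f s") auto
  then have "\<exists>v. v \<in> S \<and> (\<forall>w\<in>S. ?f v \<le> ?f w)"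
    using v(1) by blast
  then show ?thesis
    unfolding closest_point_wrt_def by (rule someI2_ex) blast
qed

lemma drift_in_closure_range:
  fixes T :: "'h::euclidean_space \<Rightarrow> 'h"
  assumes "linear G" "0 < m" "\<And>z. m * (z \<bullet> z) \<le> z \<bullet> G z"
  shows "drift G T \<in> closure (range (residual T))"
  unfolding drift_def using assms by (intro closest_point_wrt_in[where m = m]) auto

lemma drift_gap_tendsto_0:
  assumes "drift G T \<in> closure (range (residual T))"
  shows "(drift_gap G T \<longlongrightarrow> 0) at_top"
proof (rule tendstoI)
  fix e :: real assume "0 < e"
  then obtain z where z: "dist (residual T z) (drift G T) < e"
    using assms by (fastforce simp: closure_approachable)
  show "\<forall>\<^sub>F D in at_top. dist (drift_gap G T D) 0 < e"
    using eventually_ge_at_top[of "norm z"]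
  proof eventually_elim
    case (elim D)
    have "drift_gap G T D \<le> norm (residual T z - drift G T)"
      unfolding drift_gap_def using elim by (intro cINF_lower bdd_belowI2[where m = 0]) auto
    moreover have "0 \<le> drift_gap G T D"
      unfolding drift_gap_def using elim by (intro cINF_greatest) auto
    ultimately show ?case
      using z by (simp add: dist_norm)
  qed
qed

lemma fix_radius_le:
  assumes "z \<in> fixed_points T"
  shows "fix_radius T \<le> norm z"
  unfolding fix_radius_def using assms by (intro cINF_lower bdd_belowI2[where m = 0]) auto

lemma fix_radius_minus_norm_le_infdist:
  assumes "fixed_points T \<noteq> {}"
  shows "fix_radius T - norm z \<le> infdist z (fixed_points T)"
proof -
  have "fix_radius T - norm z \<le> dist z w" if "w \<in> fixed_points T" for w
    using fix_radius_le[OF that] norm_triangle_ineq2[of w z]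
    by (simp add: dist_norm norm_minus_commute)
  then show ?thesis
    using assms by (simp add: infdist_def cINF_greatest)
qed

text \<open>
  The vector \<open>v\<close> stands for the drift of \<open>T\<close>. Splitting the residual of \<open>T'\<close> at \<open>z\<close> into perturbation,
  deviation from \<open>v\<close>, and \<open>v\<close> itself bounds the numerator, while the denominator is large because
  \<open>z\<close> lies well inside the smallest ball around the origin that reaches a fixed point of \<open>T'\<close>.
\<close>

lemma quotient_le_far_from_fixed_points:
  assumes "fixed_points T' \<noteq> {}" "norm z \<le> R" "R < fix_radius T'"
    and "norm (T' z - T z) \<le> p" "norm (residual T z - v) \<le> q"
  shows "norm (residual T' z) / infdist z (fixed_points T') \<le> (p + q + norm v) / (fix_radius T' - R)"
proof (rule frac_le)
  have "residual T' z = (T' z - T z) + (residual T z - v) + v"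
    by (simp add: residual_def)
  also have "norm \<dots> \<le> p + q + norm v"
    using assms(4,5) by (intro norm_triangle_mono order_refl)
  finally show "norm (residual T' z) \<le> p + q + norm v" .
  then show "0 \<le> p + q + norm v"
    using norm_ge_zero order_trans by blast
qed (use assms fix_radius_minus_norm_le_infdist[OF assms(1), of z] in auto)

lemma nonneg_vanishing_modulus_le:
  assumes "S \<epsilon> \<noteq> {}"
    and "\<And>z. z \<in> S \<epsilon> \<Longrightarrow> norm (residual (T (\<theta>c \<epsilon>)) z) / infdist z (fixed_points (T (\<theta>c \<epsilon>))) \<le> B"
  shows "0 \<le> vanishing_modulus T \<theta>c S \<epsilon>" "vanishing_modulus T \<theta>c S \<epsilon> \<le> B"
proof -
  obtain z where z: "z \<in> S \<epsilon>"
    using assms(1) by blast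
  have "0 \<le> norm (residual (T (\<theta>c \<epsilon>)) z) / infdist z (fixed_points (T (\<theta>c \<epsilon>)))"
    by (simp add: infdist_nonneg)
  also have "\<dots> \<le> vanishing_modulus T \<theta>c S \<epsilon>"
    unfolding vanishing_modulus_def using z assms(2) by (intro cSUP_upper bdd_aboveI2[where M = B]) auto
  finally show "0 \<le> vanishing_modulus T \<theta>c S \<epsilon>" .
  show "vanishing_modulus T \<theta>c S \<epsilon> \<le> B"
    unfolding vanishing_modulus_def using assms by (intro cSUP_least) auto
qed

theorem theorem2p11:
  fixes K :: "'x::euclidean_space set"
    and U :: "('x, 'y::euclidean_space) param set"
    and \<theta>bar :: "('x, 'y) param"
    and T :: "('x, 'y) param \<Rightarrow> 'h::euclidean_space \<Rightarrow> 'h"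
    and G :: "('x, 'y) param \<Rightarrow> 'h \<Rightarrow> 'h"
    and \<theta>c :: "real \<Rightarrow> ('x, 'y) param"
    and \<gamma> :: real
    and \<nu> :: "real \<Rightarrow> real"
    and D :: "real \<Rightarrow> real"
    and S :: "real \<Rightarrow> 'h set"
  defines "D \<equiv> \<lambda>\<epsilon>. fix_radius (T (\<theta>c \<epsilon>))"
    and "S \<equiv> \<lambda>\<epsilon>. gap_region (G \<theta>bar) (T \<theta>bar) (D \<epsilon> powr \<gamma>) (\<nu> \<epsilon>)"
  assumes cone: "closed K" "convex_cone K"
    and U: "compact U" "\<theta>bar \<in> U" "\<theta>bar \<in> closure (D_KKT K)"
    and fix_iff: "\<forall>\<theta>\<in>U. fixed_points (T \<theta>) \<noteq> {} \<longleftrightarrow> \<theta> \<in> D_KKT K"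
    and metric: "\<forall>\<theta>\<in>U. selfadjoint_posdef (G \<theta>)"
    and averaged: "\<forall>\<theta>\<in>U. \<exists>\<alpha>. 0 < \<alpha> \<and> \<alpha> < 1 \<and> averaged_wrt (G \<theta>) \<alpha> (T \<theta>)"
    and metric_bounds: "\<exists>m M. 0 < m \<and> m \<le> M \<and>
      (\<forall>\<theta>\<in>U. \<forall>z. m * (z \<bullet> z) \<le> z \<bullet> G \<theta> z \<and> z \<bullet> G \<theta> z \<le> M * (z \<bullet> z))"
    and lipschitz: "\<exists>a a'. 0 \<le> a \<and> 0 \<le> a' \<and>
      (\<forall>\<theta>\<in>U. \<forall>\<theta>'\<in>U. \<forall>z. norm (T \<theta> z - T \<theta>' z) \<le> (a + a' * norm z) * norm (\<theta> - \<theta>'))"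
    and center: "center_family K U \<theta>bar \<theta>c"
    and D_at_top: "filterlim D at_top (at_right 0)"
    and \<gamma>: "0 < \<gamma>" "\<gamma> < 1"
    and \<nu>: "\<forall>\<^sub>F \<epsilon> in at_right 0. 0 \<le> \<nu> \<epsilon>" "(\<nu> \<longlongrightarrow> 0) (at_right 0)"
  shows "petal_family U \<theta>bar (\<lambda>_. \<theta>bar) \<and>
    ASR_family G T \<theta>c (\<lambda>_. \<theta>bar) S \<and>
    vanishing_modulus T \<theta>c S \<in>
      O[at_right 0](\<lambda>\<epsilon>. inverse (D \<epsilon>) + D \<epsilon> powr (\<gamma> - 1) * norm (\<theta>c \<epsilon> - \<theta>bar))"
proof -
  obtain m M where mM: "0 < m" "m \<le> M"
    and bounds: "\<And>\<theta> z. \<theta> \<in> U \<Longrightarrow> m * (z \<bullet> z) \<le> z \<bullet> G \<theta> z"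
      "\<And>\<theta> z. \<theta> \<in> U \<Longrightarrow> z \<bullet> G \<theta> z \<le> M * (z \<bullet> z)"
    using metric_bounds by blast
  obtain a a' where a: "0 \<le> a" "0 \<le> a'"
    and lip: "\<And>\<theta> \<theta>' z. \<theta> \<in> U \<Longrightarrow> \<theta>' \<in> U \<Longrightarrow>
      norm (T \<theta> z - T \<theta>' z) \<le> (a + a' * norm z) * norm (\<theta> - \<theta>')"
    using lipschitz by blast
  define v where "v = drift (G \<theta>bar) (T \<theta>bar)"
  define n where "n = (\<lambda>\<epsilon>. norm (\<theta>c \<epsilon> - \<theta>bar))"
  define R where "R = (\<lambda>\<epsilon>. D \<epsilon> powr \<gamma>)"
  define \<mu> where "\<mu> = (\<lambda>\<epsilon>. drift_gap (G \<theta>bar) (T \<theta>bar) (R \<epsilon>) + \<nu> \<epsilon>)"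
  define rate where "rate = (\<lambda>\<epsilon>. inverse (D \<epsilon>) + D \<epsilon> powr (\<gamma> - 1) * n \<epsilon>)"
  \<comment> \<open>Dividing by \<open>D \<epsilon> / 2\<close> gives the factor 2; the term \<open>a * n \<epsilon>\<close> and the deviation \<open>\<mu> \<epsilon>\<close> are
    eventually at most \<open>a\<close> and \<open>1\<close>, so with \<open>norm v\<close> they contribute to the coefficient of
    \<open>inverse (D \<epsilon>)\<close>, while \<open>a'\<close> is the coefficient of the second term of the rate.\<close>
  define C where "C = 2 * (a + a' + 1 + norm v)"
  define Q where "Q = (\<lambda>\<epsilon> z. norm (residual (T (\<theta>c \<epsilon>)) z) / infdist z (fixed_points (T (\<theta>c \<epsilon>))))"

  have in_S: "z \<in> S \<epsilon> \<longleftrightarrow> norm z \<le> R \<epsilon> \<and> norm (residual (T \<theta>bar) z - v) \<le> \<mu> \<epsilon>" for z \<epsilon>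
    by (simp add: S_def gap_region_def R_def v_def \<mu>_def)
  have cont: "continuous_on UNIV (T \<theta>bar)"
    using averaged U(2) mM bounds[OF U(2)]
    by (meson continuous_on_averaged less_imp_le order_trans)
  have drift: "drift (G \<theta>bar) (T \<theta>bar) \<in> closure (range (residual (T \<theta>bar)))"
    using metric U(2) mM(1) bounds(1)[OF U(2)]
    by (intro drift_in_closure_range[where m = m]) (auto simp: selfadjoint_posdef_def)

  have R_at_top: "filterlim R at_top (at_right 0)"
    unfolding R_def using \<gamma>(1) by (intro filterlim_compose[OF real_powr_at_top D_at_top])
  have \<mu>_0: "(\<mu> \<longlongrightarrow> 0) (at_right 0)"
    unfolding \<mu>_def
    using tendsto_add[OF filterlim_compose[OF drift_gap_tendsto_0[OF drift] R_at_top] \<nu>(2)] by simp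
  have n_0: "(n \<longlongrightarrow> 0) (at_right 0)"
    using center unfolding center_family_def n_def by (simp add: tendsto_norm_zero_iff LIM_zero_iff)
  have powr_0: "((\<lambda>\<epsilon>. D \<epsilon> powr (\<gamma> - 1)) \<longlongrightarrow> 0) (at_right 0)"
    using \<gamma>(2) by (intro tendsto_neg_powr D_at_top) simp
  have rate_0: "(rate \<longlongrightarrow> 0) (at_right 0)"
    unfolding rate_def
    using tendsto_add[OF tendsto_inverse_0_at_top[OF D_at_top] tendsto_mult[OF powr_0 n_0]] by simp

  have "\<forall>\<^sub>F \<epsilon> in at_right 0. \<theta>c \<epsilon> \<in> U \<and> fixed_points (T (\<theta>c \<epsilon>)) \<noteq> {}"
    using center fix_iff by (auto simp: center_family_def elim!: eventually_mono)
  moreover have "\<forall>\<^sub>F \<epsilon> in at_right 0. n \<epsilon> < 1"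
    using n_0 by (rule order_tendstoD) simp
  moreover have "\<forall>\<^sub>F \<epsilon> in at_right 0. \<mu> \<epsilon> < 1"
    using \<mu>_0 by (rule order_tendstoD) simp
  moreover have "\<forall>\<^sub>F \<epsilon> in at_right 0. D \<epsilon> powr (\<gamma> - 1) < 1 / 2"
    using powr_0 by (rule order_tendstoD) simp
  moreover have "\<forall>\<^sub>F \<epsilon> in at_right 0. 1 \<le> D \<epsilon>"
    using D_at_top by (simp add: filterlim_at_top)
  ultimately have good: "\<forall>\<^sub>F \<epsilon> in at_right 0. S \<epsilon> \<noteq> {} \<and> S \<epsilon> \<inter> fixed_points (T (\<theta>c \<epsilon>)) = {} \<and>
    0 \<le> \<mu> \<epsilon> \<and> 0 \<le> rate \<epsilon> \<and> (\<forall>z\<in>S \<epsilon>. Q \<epsilon> z \<le> C * rate \<epsilon>)"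
    using \<nu>(1)
  proof eventually_elim
    case (elim \<epsilon>)
    have R_eq: "R \<epsilon> = D \<epsilon> * D \<epsilon> powr (\<gamma> - 1)"
      using elim by (simp add: R_def powr_diff)
    have R: "0 \<le> R \<epsilon>" "R \<epsilon> \<le> D \<epsilon> / 2"
      using elim mult_left_mono[of "D \<epsilon> powr (\<gamma> - 1)" "1 / 2" "D \<epsilon>"] by (simp_all add: R_eq)
    obtain z where z: "norm z \<le> R \<epsilon>" "norm (residual (T \<theta>bar) z - v) \<le> \<mu> \<epsilon>"
      using drift_gap_attained[OF cont R(1), of "G \<theta>bar"] elim unfolding \<mu>_def v_def
      by (metis le_add_same_cancel1)
    have "z \<notin> fixed_points (T (\<theta>c \<epsilon>))" if "z \<in> S \<epsilon>" for z
      using that in_S fix_radius_le[of z "T (\<theta>c \<epsilon>)"] R elim by (fastforce simp: D_def)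
    moreover have "Q \<epsilon> z \<le> C * rate \<epsilon>" if "z \<in> S \<epsilon>" for z
    proof -
      have z: "norm z \<le> R \<epsilon>" "norm (residual (T \<theta>bar) z - v) \<le> \<mu> \<epsilon>"
        using that by (auto simp: in_S)
      have "norm (T (\<theta>c \<epsilon>) z - T \<theta>bar z) \<le> (a + a' * norm z) * n \<epsilon>"
        unfolding n_def using elim U(2) by (intro lip) auto
      also have "\<dots> \<le> (a + a' * R \<epsilon>) * n \<epsilon>"
        using z(1) a by (intro mult_right_mono add_left_mono mult_left_mono) (auto simp: n_def)
      finally have p: "norm (T (\<theta>c \<epsilon>) z - T \<theta>bar z) \<le> (a + a' * R \<epsilon>) * n \<epsilon>" .
      have "Q \<epsilon> z \<le> ((a + a' * R \<epsilon>) * n \<epsilon> + \<mu> \<epsilon> + norm v) / (D \<epsilon> - R \<epsilon>)"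
        unfolding Q_def D_def using z p R elim
        by (intro quotient_le_far_from_fixed_points[where T = "T \<theta>bar"]) (auto simp: D_def)
      also have "\<dots> \<le> (a + a' * R \<epsilon> * n \<epsilon> + 1 + norm v) / (D \<epsilon> / 2)"
      proof (rule frac_le)
        have "a * n \<epsilon> \<le> a"
          using a elim by (simp add: mult_left_le)
        then show "(a + a' * R \<epsilon>) * n \<epsilon> + \<mu> \<epsilon> + norm v \<le> a + a' * R \<epsilon> * n \<epsilon> + 1 + norm v"
          using elim by (simp add: algebra_simps)
      qed (use a R elim in \<open>auto simp: n_def\<close>)
      also have "\<dots> = 2 * (a + 1 + norm v) * inverse (D \<epsilon>) + 2 * a' * (D \<epsilon> powr (\<gamma> - 1) * n \<epsilon>)"
        using elim by (simp add: R_eq field_simps)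
      also have "\<dots> \<le> C * inverse (D \<epsilon>) + C * (D \<epsilon> powr (\<gamma> - 1) * n \<epsilon>)"
        using a elim by (intro add_mono mult_right_mono) (auto simp: C_def n_def)
      finally show ?thesis
        by (simp add: rate_def distrib_left)
    qed
    moreover have "S \<epsilon> \<noteq> {}" "0 \<le> \<mu> \<epsilon>"
      using z in_S norm_ge_zero order_trans by blast+
    moreover have "0 \<le> rate \<epsilon>"
      using elim by (simp add: rate_def n_def)
    ultimately show ?case
      by blast
  qed

  have modulus: "\<forall>\<^sub>F \<epsilon> in at_right 0.
    0 \<le> vanishing_modulus T \<theta>c S \<epsilon> \<and> vanishing_modulus T \<theta>c S \<epsilon> \<le> C * rate \<epsilon>"
    using good
  proof eventually_elim
    case (elim \<epsilon>)
    then show ?case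
      using nonneg_vanishing_modulus_le[of S \<epsilon> T \<theta>c "C * rate \<epsilon>"] by (simp add: Q_def)
  qed
  have "((\<lambda>\<epsilon>. C * rate \<epsilon>) \<longlongrightarrow> 0) (at_right 0)"
    using tendsto_mult_left[OF rate_0, of C] by simp
  then have "(vanishing_modulus T \<theta>c S \<longlongrightarrow> 0) (at_right 0)"
    using modulus unfolding eventually_conj_iff
    by (elim conjE) (rule tendsto_sandwich[OF _ _ tendsto_const])
  moreover have "\<forall>\<^sub>F \<epsilon> in at_right 0. bdd_above (Q \<epsilon> ` S \<epsilon>)"
    using good by eventually_elim (auto intro!: bdd_aboveI2)
  ultimately have SR: "SR_family T \<theta>c S"
    using good unfolding SR_family_def Q_def eventually_conj_iff by blast
  have "ASR_family G T \<theta>c (\<lambda>_. \<theta>bar) S"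
    unfolding ASR_family_def
  proof (intro conjI SR exI[of _ \<mu>] \<mu>_0)
    show "\<forall>\<^sub>F \<epsilon> in at_right 0. 0 \<le> \<mu> \<epsilon>"
      using good by eventually_elim blast
    show "\<forall>\<^sub>F \<epsilon> in at_right 0. \<forall>z\<in>S \<epsilon>.
        norm (residual (T \<theta>bar) z - drift (G \<theta>bar) (T \<theta>bar)) \<le> \<mu> \<epsilon>"
      using in_S by (simp add: v_def)
  qed
  moreover have "vanishing_modulus T \<theta>c S \<in> O[at_right 0](rate)"
  proof (rule bigoI)
    show "\<forall>\<^sub>F \<epsilon> in at_right 0. norm (vanishing_modulus T \<theta>c S \<epsilon>) \<le> C * norm (rate \<epsilon>)"
      using modulus good by eventually_elim simp
  qed
  moreover have "petal_family U \<theta>bar (\<lambda>_. \<theta>bar)"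
    using U(2) by (simp add: petal_family_def)
  ultimately show ?thesis
    by (simp add: rate_def n_def)
qed

end
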